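(* Let $F\colon[0,+\infty)\to[0,+\infty)$ be a strictly increasing subadditive function with $F(0)=0$. If $\alpha$ is a real number with $0\leq\alpha<1-\beta(F)$, then there exists an integer $N\geq1$ such that $$n^{\alpha}\leq c_F(P_n)$$ for all integers $n\geq N$.
   Context: For $F$ as in the statement, put $D_F(a):=\sup_{x>0}\frac{F(ax)}{F(x)}$ for $a\geq0$ (this is finite), and define the upper index of $F$ by $$\beta(F):=\lim_{a\to+\infty}\frac{\log D_F(a)}{\log a};$$ this limit exists and $0\leq\beta(F)\leq1$. For a metric space $(Y,d_Y)$, $F[Y]$ denotes the set $Y$ equipped with the function $F\circ d_Y$, a non-negative symmetric function vanishing on the diagonal. For sets $X,Y$ equipped with such functions $\rho_X,\rho_Y$ and a map $f\colon X\to Y$, $\operatorname{Lip}(f):=\inf\{L\geq0:\rho_Y(f(x),f(x'))\leq L\,\rho_X(x,x')\ \forall x,x'\in X\}$ (with $\inf\varnothing=+\infty$). For injective $f\colon X\to Y$, $\operatorname{dist}(f):=\operatorname{Lip}(f)\operatorname{Lip}(f^{-1})$, where $f^{-1}\colon f(X)\to X$, and $c_Y(X):=\inf\{\operatorname{dist}(f):f\colon X\to Y\text{ injective}\}$. For a metric space $(X,d_X)$, $$c_F(X):=\inf\{c_{F[Y]}(X):(Y,d_Y)\text{ a metric space}\}.$$ Finally, $P_n:=\{0,1,\ldots,n\}\subset\mathbb{R}$ with the metric induced from $\mathbb{R}$. *)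

theory Defs
  imports "HOL-Analysis.Analysis"
begin

definition subadditive_on_nonneg :: "(real \<Rightarrow> real) \<Rightarrow> bool" where
  "subadditive_on_nonneg F \<longleftrightarrow> (\<forall>x\<ge>0. \<forall>y\<ge>0. F (x + y) \<le> F x + F y)"

(* The supremum is taken in the reals.  For strictly increasing subadditive F with F 0 = 0
   the quotients are bounded by the ceiling of a, so it is a genuine supremum. *)
definition dilation_sup :: "(real \<Rightarrow> real) \<Rightarrow> real \<Rightarrow> real" where
  "dilation_sup F a = (SUP x\<in>{0<..}. F (a * x) / F x)"

definition upper_index :: "(real \<Rightarrow> real) \<Rightarrow> real" where
  "upper_index F = Lim at_top (\<lambda>a. ln (dilation_sup F a) / ln a)"

(* Sets equipped with a non-negative symmetric function are passed as a carrier together with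
   that function.  The infimum of the empty set is \<infinity> in ennreal. *)
definition lip_const ::
    "'a set \<Rightarrow> ('a \<Rightarrow> 'a \<Rightarrow> real) \<Rightarrow> ('b \<Rightarrow> 'b \<Rightarrow> real) \<Rightarrow> ('a \<Rightarrow> 'b) \<Rightarrow> ennreal" where
  "lip_const X rX rY f =
     Inf (ennreal ` {L. 0 \<le> L \<and> (\<forall>x\<in>X. \<forall>x'\<in>X. rY (f x) (f x') \<le> L * rX x x')})"

(* The convention 0 * \<infinity> = 0 of ennreal plays no role when rX and rY are positive off the
   diagonal: for injective f, lip_const = 0 then forces X to have at most one point, and both
   factors vanish. *)
definition distortion ::
    "'a set \<Rightarrow> ('a \<Rightarrow> 'a \<Rightarrow> real) \<Rightarrow> ('b \<Rightarrow> 'b \<Rightarrow> real) \<Rightarrow> ('a \<Rightarrow> 'b) \<Rightarrow> ennreal" where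
  "distortion X rX rY f = lip_const X rX rY f * lip_const (f ` X) rY rX (inv_into X f)"

definition target_distortion ::
    "'b set \<Rightarrow> ('b \<Rightarrow> 'b \<Rightarrow> real) \<Rightarrow> 'a set \<Rightarrow> ('a \<Rightarrow> 'a \<Rightarrow> real) \<Rightarrow> ennreal" where
  "target_distortion Y rY X rX = (INF f\<in>{f. f \<in> X \<rightarrow> Y \<and> inj_on f X}. distortion X rX rY f)"

definition transform_dist :: "(real \<Rightarrow> real) \<Rightarrow> ('b \<Rightarrow> 'b \<Rightarrow> real) \<Rightarrow> 'b \<Rightarrow> 'b \<Rightarrow> real" where
  "transform_dist F d = (\<lambda>y y'. F (d y y'))"

(* HOL cannot quantify over metric spaces of all types, so Y ranges over the metric spaces
   carried by subsets of the type of X.  Nothing is lost: by lemma F_distortion_le below,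
   F_distortion F X dX is a lower bound of the constants of metric spaces of every type, hence
   it is the infimum over all of them. *)
definition F_distortion ::
    "(real \<Rightarrow> real) \<Rightarrow> 'a set \<Rightarrow> ('a \<Rightarrow> 'a \<Rightarrow> real) \<Rightarrow> ennreal" where
  "F_distortion F X dX =
     (INF (Y, dY)\<in>{(Y :: 'a set, dY). Metric_space Y dY}.
        target_distortion Y (transform_dist F dY) X dX)"

lemma F_distortion_le:
  fixes X :: "'a set" and Y :: "'b set"
  assumes "Metric_space Y dY"
  shows "F_distortion F X dX \<le> target_distortion Y (transform_dist F dY) X dX"
  unfolding target_distortion_def
proof (rule INF_greatest, clarify)
  fix f :: "'a \<Rightarrow> 'b"
  assume f: "f \<in> X \<rightarrow> Y" "inj_on f X"
  interpret Y: Metric_space Y dY by fact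
  define d where "d = (\<lambda>x x'. dY (f x) (f x'))"
  have d: "Metric_space X d"
  proof
    show "0 \<le> d x y" "d x y = d y x" for x y
      by (simp_all add: d_def Y.commute)
    show "(d x y = 0) = (x = y)" if "x \<in> X" "y \<in> X" for x y
    proof -
      have "f x \<in> Y" "f y \<in> Y" using f(1) that by auto
      then show ?thesis using inj_onD[OF f(2)] that by (auto simp: d_def)
    qed
    show "d x z \<le> d x y + d y z" if "x \<in> X" "y \<in> X" "z \<in> X" for x y z
    proof -
      have "f x \<in> Y" "f y \<in> Y" "f z \<in> Y" using f(1) that by auto
      then show ?thesis by (simp add: d_def Y.triangle)
    qed
  qed
  have inv: "inv_into X (\<lambda>x. x) x = x" if "x \<in> X" for x
    using inv_into_f_f[of "\<lambda>x. x" X x] that by simp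
  have "F_distortion F X dX \<le> target_distortion X (transform_dist F d) X dX"
    unfolding F_distortion_def by (rule INF_lower2[of "(X, d)"]) (use d in auto)
  also have "\<dots> \<le> distortion X dX (transform_dist F d) (\<lambda>x. x)"
    unfolding target_distortion_def by (rule INF_lower) auto
  also have "\<dots> = distortion X dX (transform_dist F dY) f"
    using f(2) by (simp add: distortion_def lip_const_def transform_dist_def d_def inv)
  finally show "F_distortion F X dX \<le> distortion X dX (transform_dist F dY) f" .
qed

definition path_points :: "nat \<Rightarrow> real set" where
  "path_points n = real ` {0..n}"

end

theory Submission
  imports Defs
begin

text \<open>
  Write \<open>D\<close> for \<open>dilation_sup F\<close>.  A function from the path into a metric space whose consecutive
  values are at distance at most \<open>\<delta>\<close> has its endpoints at distance at most \<open>n * \<delta>\<close>, by the triangle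
  inequality.  After applying \<open>F\<close> this says that the endpoints are at most \<open>D n\<close> times as far apart
  as some pair of consecutive points (\<open>endpoints_le_dilation_sup\<close>), whereas in the path they are
  \<open>n\<close> times as far apart.  An injection into the transformed space therefore has
  distortion at least \<open>n / D n\<close> (\<open>F_distortion_path_ge\<close>).

  It remains to see that \<open>D n\<close> is eventually below \<open>n powr (1 - \<alpha>)\<close>.  This would be the definition of
  the upper index, except that \<open>Lim\<close> says something only if the limit exists.  Existence
  is Fekete's lemma (\<open>fekete_mono\<close>) for \<open>\<lambda>t. ln (D (exp t))\<close>, which is subadditive because \<open>D\<close> is
  submultiplicative.
\<close>

section \<open>Fekete's lemma for monotone functions\<close>

lemma subadditive_scale:
  assumes "subadditive_on_nonneg g" "0 \<le> x"
  shows "g (real (Suc k) * x) \<le> real (Suc k) * g x"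
proof (induction k)
  case (Suc k)
  have "g (real (Suc k) * x + x) \<le> g (real (Suc k) * x) + g x"
    using assms unfolding subadditive_on_nonneg_def by (meson mult_nonneg_nonneg of_nat_0_le_iff)
  with Suc show ?case by (simp add: algebra_simps)
qed simp

text \<open>
  Round \<open>t\<close> up to a multiple of a fixed \<open>s\<close>: monotonicity pays for the rounding and subadditivity
  for the multiple, so \<open>g t / t\<close> exceeds \<open>g s / s\<close> by at most \<open>g s / t\<close>, which vanishes in the limit.
\<close>

lemma fekete_mono:
  fixes g :: "real \<Rightarrow> real"
  assumes mono: "mono_on {0..} g" and sub: "subadditive_on_nonneg g"
    and nonneg: "\<And>t. 0 \<le> t \<Longrightarrow> 0 \<le> g t"
  shows "((\<lambda>t. g t / t) \<longlongrightarrow> (INF t\<in>{0<..}. g t / t)) at_top"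
proof -
  have bdd: "bdd_below ((\<lambda>t. g t / t) ` {0<..})"
    by (rule bdd_belowI2[of _ 0]) (simp add: nonneg)
  have upper: "g t / t \<le> g s / s + g s / t" if "0 < s" "0 < t" for s t
  proof -
    define k where "k = nat \<lfloor>t / s\<rfloor>"
    have k: "real k \<le> t / s" "t / s \<le> real (Suc k)"
      using divide_pos_pos[OF that(2,1)] unfolding k_def by linarith+
    have "t \<le> real (Suc k) * s" using k(2) that by (simp add: field_simps)
    then have "g t \<le> g (real (Suc k) * s)"
      using that by (intro mono_onD[OF mono]) auto
    also have "\<dots> \<le> real (Suc k) * g s"
      using that by (intro subadditive_scale[OF sub]) auto
    also have "\<dots> \<le> (t / s + 1) * g s"
      using k(1) that by (intro mult_right_mono nonneg) auto
    finally show ?thesis using that by (simp add: field_simps)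
  qed
  show ?thesis
  proof (rule order_tendstoI)
    fix y assume y: "y < (INF t\<in>{0<..}. g t / t)"
    show "\<forall>\<^sub>F t in at_top. y < g t / t"
      using eventually_gt_at_top[of 0]
    proof eventually_elim
      case (elim t)
      then have "(INF t\<in>{0<..}. g t / t) \<le> g t / t"
        by (intro cINF_lower[OF bdd]) auto
      with y show ?case by simp
    qed
  next
    fix y assume "(INF t\<in>{0<..}. g t / t) < y"
    then obtain s where s: "0 < s" "g s / s < y"
      using bdd by (auto simp: cINF_less_iff)
    have "((\<lambda>t. g s / s + g s / t) \<longlongrightarrow> g s / s + 0) at_top"
      by (intro tendsto_intros tendsto_divide_0[OF tendsto_const]
          filterlim_at_top_imp_at_infinity filterlim_ident)
    then have "\<forall>\<^sub>F t in at_top. g s / s + g s / t < y"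
      using s by (intro order_tendstoD(2)) auto
    then show "\<forall>\<^sub>F t in at_top. g t / t < y"
      using eventually_gt_at_top[of 0]
      by eventually_elim (use upper[OF s(1)] in fastforce)
  qed
qed

section \<open>Growth of the dilation function\<close>

locale increasing_subadditive =
  fixes F :: "real \<Rightarrow> real"
  assumes incr: "strict_mono_on {0..} F"
    and subadd: "subadditive_on_nonneg F"
    and F_zero: "F 0 = 0"
begin

lemma F_mono: "0 \<le> x \<Longrightarrow> x \<le> y \<Longrightarrow> F x \<le> F y"
  by (intro mono_onD[OF strict_mono_on_imp_mono_on[OF incr]]) auto

lemma F_pos: "0 < x \<Longrightarrow> 0 < F x"
  using strict_mono_onD[OF incr, of 0 x] F_zero by simp

lemma bdd_above_quotients:
  assumes "0 \<le> a"
  shows "bdd_above ((\<lambda>x. F (a * x) / F x) ` {0<..})"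
proof (rule bdd_aboveI2)
  fix x :: real assume "x \<in> {0<..}"
  then have x: "0 < x" by simp
  define k where "k = nat \<lceil>a\<rceil>"
  have "a \<le> real (Suc k)" unfolding k_def by linarith
  then have "F (a * x) \<le> F (real (Suc k) * x)"
    using x assms by (intro F_mono mult_right_mono) auto
  also have "\<dots> \<le> real (Suc k) * F x"
    using x by (intro subadditive_scale[OF subadd]) auto
  finally show "F (a * x) / F x \<le> real (Suc (nat \<lceil>a\<rceil>))"
    using F_pos[OF x] by (simp add: field_simps k_def)
qed

lemma F_le_dilation_sup:
  assumes "0 \<le> a" "0 < x"
  shows "F (a * x) \<le> dilation_sup F a * F x"
proof -
  have "F (a * x) / F x \<le> dilation_sup F a"
    unfolding dilation_sup_def using assms
    by (intro cSUP_upper bdd_above_quotients) auto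
  then show ?thesis using F_pos[OF assms(2)] by (simp add: field_simps)
qed

lemma dilation_sup_least:
  assumes "\<And>x. 0 < x \<Longrightarrow> F (a * x) \<le> c * F x"
  shows "dilation_sup F a \<le> c"
  unfolding dilation_sup_def
  by (rule cSUP_least) (use assms F_pos in \<open>auto simp: divide_le_eq\<close>)

lemma dilation_sup_mono:
  assumes "0 \<le> a" "a \<le> b"
  shows "dilation_sup F a \<le> dilation_sup F b"
proof (rule dilation_sup_least)
  fix x :: real assume x: "0 < x"
  have "F (a * x) \<le> F (b * x)" using assms x by (intro F_mono mult_right_mono) auto
  also have "\<dots> \<le> dilation_sup F b * F x" using assms x by (intro F_le_dilation_sup) auto
  finally show "F (a * x) \<le> dilation_sup F b * F x" .
qed

lemma dilation_sup_ge_1: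
  assumes "1 \<le> a"
  shows "1 \<le> dilation_sup F a"
proof -
  have "F 1 \<le> F a" using assms by (intro F_mono) auto
  also have "\<dots> \<le> dilation_sup F a * F 1" using F_le_dilation_sup[of a 1] assms by simp
  finally show ?thesis using F_pos[of 1] by simp
qed

lemma dilation_sup_mult:
  assumes "1 \<le> a" "1 \<le> b"
  shows "dilation_sup F (a * b) \<le> dilation_sup F a * dilation_sup F b"
proof (rule dilation_sup_least)
  fix x :: real assume x: "0 < x"
  have "F (a * (b * x)) \<le> dilation_sup F a * F (b * x)"
    using assms x by (intro F_le_dilation_sup) auto
  also have "\<dots> \<le> dilation_sup F a * (dilation_sup F b * F x)"
    using assms x dilation_sup_ge_1[of a] by (intro mult_left_mono F_le_dilation_sup) auto
  finally show "F (a * b * x) \<le> dilation_sup F a * dilation_sup F b * F x"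
    by (simp add: mult.assoc)
qed

text \<open>
  Fekete's lemma applies in logarithmic coordinates \<open>a = exp t\<close>, where submultiplicativity becomes
  subadditivity; on \<open>t \<ge> 0\<close> the logarithm is nonnegative by \<open>dilation_sup_ge_1\<close>.
\<close>

lemma upper_index_tendsto:
  "((\<lambda>a. ln (dilation_sup F a) / ln a) \<longlongrightarrow> upper_index F) at_top"
proof -
  define g where "g t = ln (dilation_sup F (exp t))" for t
  define m where "m = (INF t\<in>{0<..}. g t / t)"
  have ge1: "1 \<le> dilation_sup F (exp t)" if "0 \<le> t" for t
    using that by (intro dilation_sup_ge_1) simp
  have "mono_on {0..} g"
  proof (rule mono_onI)
    fix s t :: real assume st: "s \<in> {0..}" "t \<in> {0..}" "s \<le> t"
    then have "dilation_sup F (exp s) \<le> dilation_sup F (exp t)"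
      by (intro dilation_sup_mono) auto
    then show "g s \<le> g t" using ge1[of s] st by (simp add: g_def)
  qed
  moreover have "subadditive_on_nonneg g"
    unfolding subadditive_on_nonneg_def
  proof (intro allI impI)
    fix s t :: real assume st: "0 \<le> s" "0 \<le> t"
    have "g (s + t) \<le> ln (dilation_sup F (exp s) * dilation_sup F (exp t))"
      unfolding g_def using ge1[of "s + t"] dilation_sup_mult[of "exp s" "exp t"] st
      by (intro ln_mono) (auto simp: exp_add)
    also have "\<dots> = g s + g t"
      unfolding g_def using ge1[of s] ge1[of t] st by (intro ln_mult_pos) auto
    finally show "g (s + t) \<le> g s + g t" .
  qed
  moreover have "0 \<le> g t" if "0 \<le> t" for t
    using ge1[OF that] by (simp add: g_def)
  ultimately have "((\<lambda>t. g t / t) \<longlongrightarrow> m) at_top"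
    unfolding m_def by (rule fekete_mono)
  then have "((\<lambda>a. g (ln a) / ln a) \<longlongrightarrow> m) at_top"
    by (rule filterlim_compose[OF _ ln_at_top])
  moreover have "\<forall>\<^sub>F a in at_top. g (ln a) / ln a = ln (dilation_sup F a) / ln a"
    using eventually_gt_at_top[of 0] by eventually_elim (simp add: g_def)
  ultimately have lim: "((\<lambda>a. ln (dilation_sup F a) / ln a) \<longlongrightarrow> m) at_top"
    by (rule Lim_transform_eventually)
  then have "upper_index F = m"
    unfolding upper_index_def by (intro tendsto_Lim) auto
  with lim show ?thesis by simp
qed

lemma eventually_dilation_sup_less_powr:
  assumes "upper_index F < \<gamma>"
  shows "\<forall>\<^sub>F a in at_top. dilation_sup F a < a powr \<gamma>"
  using order_tendstoD(2)[OF upper_index_tendsto assms] eventually_gt_at_top[of 1]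
proof eventually_elim
  case (elim a)
  then have "ln (dilation_sup F a) < \<gamma> * ln a" by (simp add: divide_less_eq)
  also have "\<dots> = ln (a powr \<gamma>)" using elim by (simp add: ln_powr)
  finally show ?case using elim dilation_sup_ge_1[of a] by (subst (asm) ln_less_cancel_iff) auto
qed

section \<open>Distortion of paths\<close>

lemma endpoints_le_dilation_sup:
  assumes "Metric_space Y d" and p: "\<And>i. i \<le> n \<Longrightarrow> p i \<in> Y"
    and n: "0 < n" and step: "\<And>i. i < n \<Longrightarrow> F (d (p i) (p (Suc i))) \<le> L"
    and L: "0 < L"
  shows "F (d (p 0) (p n)) \<le> dilation_sup F (real n) * L"
proof -
  interpret Metric_space Y d by fact
  have chain: "d (p 0) (p k) \<le> (\<Sum>i<k. d (p i) (p (Suc i)))" if "k \<le> n" for k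
    using that
  proof (induction k)
    case 0
    then show ?case using p[of 0] by simp
  next
    case (Suc k)
    then show ?case using triangle[of "p 0" "p k" "p (Suc k)"] p by fastforce
  qed
  define \<delta> where "\<delta> = Max ((\<lambda>i. d (p i) (p (Suc i))) ` {..<n})"
  have "\<delta> \<in> (\<lambda>i. d (p i) (p (Suc i))) ` {..<n}"
    unfolding \<delta>_def using n by (intro Max_in) auto
  then have F\<delta>: "F \<delta> \<le> L" and \<delta>: "0 \<le> \<delta>" using step by auto
  have "(\<Sum>i<n. d (p i) (p (Suc i))) \<le> real n * \<delta>"
    using sum_bounded_above[of "{..<n}" "\<lambda>i. d (p i) (p (Suc i))" \<delta>]
    by (simp add: \<delta>_def)
  then have "F (d (p 0) (p n)) \<le> F (real n * \<delta>)"
    using chain[of n] by (intro F_mono) auto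
  also have "\<dots> \<le> dilation_sup F (real n) * L"
  proof (cases "\<delta> = 0")
    case True
    then show ?thesis using L n F_zero dilation_sup_ge_1[of "real n"] by simp
  next
    case False
    then have "F (real n * \<delta>) \<le> dilation_sup F (real n) * F \<delta>"
      using \<delta> by (intro F_le_dilation_sup) auto
    also have "\<dots> \<le> dilation_sup F (real n) * L"
      using F\<delta> n dilation_sup_ge_1[of "real n"] by (intro mult_left_mono) auto
    finally show ?thesis .
  qed
  finally show ?thesis .
qed

end

text \<open>
  If one of the sets is empty, its infimum is \<open>\<infinity>\<close> and the product is \<open>\<infinity>\<close> only because the other
  factor is nonzero.  Otherwise the bound passes to the infimum one factor at a time, by dividing.
\<close>

lemma le_mult_Inf_ennreal:
  fixes c :: ennreal
  assumes "Inf A \<noteq> 0" "Inf B \<noteq> 0" "\<And>a b. a \<in> A \<Longrightarrow> b \<in> B \<Longrightarrow> c \<le> a * b"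
  shows "c \<le> Inf A * Inf B"
proof -
  have one_side: "c \<le> a * Inf B" if "a \<noteq> 0" "Inf B \<noteq> 0" "\<And>b. b \<in> B \<Longrightarrow> c \<le> a * b"
    for a :: ennreal and B
  proof (cases "a = top")
    case True
    then show ?thesis using that(2) by (simp add: ennreal_top_mult)
  next
    case False
    have "c / a \<le> Inf B"
      using that by (intro Inf_greatest divide_le_posI_ennreal) (auto simp: zero_less_iff_neq_zero)
    then have "a * (c / a) \<le> a * Inf B" by (rule mult_left_mono) simp
    then show ?thesis using that(1) False
      by (simp add: ennreal_times_divide mult_divide_eq_ennreal mult.commute[of a c])
  qed
  have "c \<le> Inf B * Inf A"
  proof (rule one_side)
    fix a assume a: "a \<in> A"
    have "a \<noteq> 0" using Inf_lower[OF a] assms(1) by auto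
    then have "c \<le> a * Inf B" using assms a by (intro one_side) auto
    then show "c \<le> Inf B * a" by (simp add: mult.commute)
  qed (use assms in auto)
  then show ?thesis by (simp add: mult.commute)
qed

text \<open>
  A Lipschitz constant \<open>L\<close> of \<open>f\<close> bounds the edges of the image, and a Lipschitz constant \<open>M\<close> of its
  inverse bounds \<open>n\<close> by \<open>M\<close> times the transformed distance of the endpoints, so the comparison of
  endpoints with edges bounds \<open>L * M\<close> from below.
\<close>

lemma (in increasing_subadditive) distortion_path_ge:
  assumes Y: "Metric_space Y d" and n: "0 < n"
    and f: "f \<in> path_points n \<rightarrow> Y" "inj_on f (path_points n)"
  shows "ennreal (real n / dilation_sup F (real n))
           \<le> distortion (path_points n) dist (transform_dist F d) f"
proof -
  interpret Metric_space Y d by fact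
  define p where "p i = f (real i)" for i
  have path: "real i \<in> path_points n" if "i \<le> n" for i
    using that by (simp add: path_points_def)
  have p: "p i \<in> Y" if "i \<le> n" for i
    using f(1) path[OF that] by (auto simp: p_def)
  have inv: "inv_into (path_points n) f (p i) = real i" if "i \<le> n" for i
    using f(2) path[OF that] by (simp add: p_def)
  \<comment> \<open>The first edge is not collapsed, so neither Lipschitz constant is \<open>0\<close>.\<close>
  have "f 0 \<noteq> f 1"
    using inj_onD[OF f(2)] path[of 0] path[of 1] n by fastforce
  then have e: "0 < F (d (p 0) (p 1))"
    using p[of 0] p[of 1] n by (intro F_pos) (simp add: p_def)
  have first: "F (d (p i) (p j)) \<le> L * \<bar>real i - real j\<bar>"
    if "\<forall>x\<in>path_points n. \<forall>x'\<in>path_points n. transform_dist F d (f x) (f x') \<le> L * dist x x'"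
      "i \<le> n" "j \<le> n" for L i j
    using that path by (auto simp: transform_dist_def p_def dist_real_def)
  have second: "\<bar>real i - real j\<bar> \<le> M * F (d (p i) (p j))"
    if "\<forall>y\<in>f ` path_points n. \<forall>y'\<in>f ` path_points n.
          dist (inv_into (path_points n) f y) (inv_into (path_points n) f y')
            \<le> M * transform_dist F d y y'"
      "i \<le> n" "j \<le> n" for M i j
  proof -
    have "p i \<in> f ` path_points n" "p j \<in> f ` path_points n"
      using that path by (auto simp: p_def)
    then have "dist (inv_into (path_points n) f (p i)) (inv_into (path_points n) f (p j))
            \<le> M * transform_dist F d (p i) (p j)" using that(1) by blast
    then show ?thesis using inv that(2,3) by (simp add: transform_dist_def dist_real_def)
  qed
  show ?thesis
    unfolding distortion_def lip_const_def
  proof (rule le_mult_Inf_ennreal, goal_cases)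
    case 1
    have "ennreal (F (d (p 0) (p 1))) \<le>
      Inf (ennreal ` {L. 0 \<le> L \<and> (\<forall>x\<in>path_points n. \<forall>x'\<in>path_points n.
            transform_dist F d (f x) (f x') \<le> L * dist x x')})"
    proof (rule INF_greatest, clarify)
      fix L assume "\<forall>x\<in>path_points n. \<forall>x'\<in>path_points n.
            transform_dist F d (f x) (f x') \<le> L * dist x x'"
      from first[OF this, of 0 1] n show "ennreal (F (d (p 0) (p 1))) \<le> ennreal L"
        by (intro ennreal_leI) simp
    qed
    then show ?case using e by (metis ennreal_eq_0_iff le_zero_eq not_le)
  next
    case 2
    have "ennreal (1 / F (d (p 0) (p 1))) \<le>
      Inf (ennreal ` {M. 0 \<le> M \<and> (\<forall>y\<in>f ` path_points n. \<forall>y'\<in>f ` path_points n.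
          dist (inv_into (path_points n) f y) (inv_into (path_points n) f y')
            \<le> M * transform_dist F d y y')})"
    proof (rule INF_greatest, clarify)
      fix M assume "\<forall>y\<in>f ` path_points n. \<forall>y'\<in>f ` path_points n.
          dist (inv_into (path_points n) f y) (inv_into (path_points n) f y')
            \<le> M * transform_dist F d y y'"
      from second[OF this, of 0 1] n e
      show "ennreal (1 / F (d (p 0) (p 1))) \<le> ennreal M"
        by (intro ennreal_leI) (simp add: field_simps)
    qed
    then show ?case using e by (metis ennreal_eq_0_iff le_zero_eq not_le zero_less_divide_1_iff)
  next
    case (3 a b)
    then obtain L M where LM: "a = ennreal L" "b = ennreal M" "0 \<le> L" "0 \<le> M"
      and L: "\<forall>x\<in>path_points n. \<forall>x'\<in>path_points n.
            transform_dist F d (f x) (f x') \<le> L * dist x x'"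
      and M: "\<forall>y\<in>f ` path_points n. \<forall>y'\<in>f ` path_points n.
          dist (inv_into (path_points n) f y) (inv_into (path_points n) f y')
            \<le> M * transform_dist F d y y'" by blast
    have step: "F (d (p i) (p (Suc i))) \<le> L" if "i < n" for i
      using first[OF L, of i "Suc i"] that by simp
    have "0 < L" using step[of 0] e n by simp
    have "real n \<le> M * F (d (p 0) (p n))" using second[OF M, of 0 n] by simp
    also have "\<dots> \<le> M * (dilation_sup F (real n) * L)"
      using LM \<open>0 < L\<close> Y n p step by (intro mult_left_mono endpoints_le_dilation_sup) auto
    finally have "real n / dilation_sup F (real n) \<le> L * M"
      using dilation_sup_ge_1[of "real n"] n by (simp add: divide_le_eq algebra_simps)
    then show ?case using LM by (simp flip: ennreal_mult)
  qed
qed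

lemma (in increasing_subadditive) F_distortion_path_ge:
  assumes "0 < n"
  shows "ennreal (real n / dilation_sup F (real n)) \<le> F_distortion F (path_points n) dist"
  unfolding F_distortion_def target_distortion_def
  using assms by (auto intro!: INF_greatest distortion_path_ge)

theorem corollary2p2:
  fixes F :: "real \<Rightarrow> real" and \<alpha> :: real
  assumes "F \<in> {0..} \<rightarrow> {0..}"
    and "strict_mono_on {0..} F"
    and "subadditive_on_nonneg F"
    and "F 0 = 0"
    and "0 \<le> \<alpha>"
    and "\<alpha> < 1 - upper_index F"
  shows "\<exists>N\<ge>1. \<forall>n\<ge>N. ennreal (real n powr \<alpha>) \<le> F_distortion F (path_points n) dist"
proof -
  interpret increasing_subadditive F by standard (use assms in auto)
  have "\<forall>\<^sub>F a in at_top. dilation_sup F a < a powr (1 - \<alpha>)"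
    using assms by (intro eventually_dilation_sup_less_powr) simp
  then have "\<forall>\<^sub>F n in sequentially. dilation_sup F (real n) < real n powr (1 - \<alpha>)"
    using filterlim_real_sequentially by (rule eventually_compose_filterlim)
  then obtain N where N: "\<And>n. N \<le> n \<Longrightarrow> dilation_sup F (real n) < real n powr (1 - \<alpha>)"
    by (auto simp: eventually_sequentially)
  have "ennreal (real n powr \<alpha>) \<le> F_distortion F (path_points n) dist" if "max N 1 \<le> n" for n
  proof -
    have n: "0 < n" "N \<le> n" using that by auto
    have "real n powr \<alpha> * dilation_sup F (real n) \<le> real n powr \<alpha> * real n powr (1 - \<alpha>)"
      using N[OF n(2)] by (intro mult_left_mono) auto
    also have "\<dots> = real n" using n by (simp flip: powr_add)
    finally have "real n powr \<alpha> \<le> real n / dilation_sup F (real n)"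
      using dilation_sup_ge_1[of "real n"] n by (simp add: le_divide_eq)
    then have "ennreal (real n powr \<alpha>) \<le> ennreal (real n / dilation_sup F (real n))"
      by (rule ennreal_leI)
    also have "\<dots> \<le> F_distortion F (path_points n) dist"
      using n(1) by (rule F_distortion_path_ge)
    finally show ?thesis .
  qed
  then show ?thesis by (intro exI[of _ "max N 1"]) auto
qed

end
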